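(* The functions $$\mathfrak{H}_{S^1}:(\mathcal{COS}(S^1),\tau_{ucc})\to\mathbb{N}_0,\qquad \mathfrak{H}_{S^1}(x\mapsto\cos(2\pi kx)):=k,$$ (where $k\in\mathbb{N}_0$) and, for a positive integer $n$, $$\mathfrak{H}_{\mathbb{Z}_n}:(\mathcal{COS}(\mathbb{Z}_n),\tau_{ucc})\to\mathbb{Z}_{\lceil\frac{n+1}{2}\rceil},\qquad \mathfrak{H}_{\mathbb{Z}_n}\left(k\mapsto\cos\left(\frac{2\pi lk}{n}\right)\right):=l,$$ (where $l\in\mathbb{Z}_{\lceil\frac{n+1}{2}\rceil}$) are homeomorphisms.
   Context: For a locally compact abelian group $G$ (written additively), with $C^b(G)$ the space of bounded continuous functions $G\to\mathbb{C}$, the cosine class is $$\mathcal{COS}(G) := \left\{\phi\in C^b(G) : \phi\neq 0,\ \forall_{x,y\in G}\ \phi(x)\phi(y)=\frac{\phi(x+y)+\phi(x-y)}{2}\right\},$$ and $\tau_{ucc}$ is the topology of uniform convergence on compact subsets of $G$. The circle group $S^1$ is identified with $\mathbb{R}/\mathbb{Z}$ (variable $x$, addition mod $1$). $\mathbb{Z}_n$ is the cyclic group of order $n$ (discrete topology), and $\mathbb{Z}_{\lceil\frac{n+1}{2}\rceil}$ is regarded as the index set $\{0,1,\ldots,\lceil\frac{n+1}{2}\rceil-1\}$, where $\lceil\cdot\rceil$ is the ceiling function. $\mathbb{N}_0=\{0,1,2,\ldots\}$ and $\mathbb{Z}_{\lceil\frac{n+1}{2}\rceil}$ carry the discrete topology.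 *)

theory Defs
  imports "HOL-Analysis.Analysis" "HOL-Algebra.Elementary_Groups"
begin

section \<open>The cosine class with the topology of uniform convergence on compacta\<close>

text \<open>
  A topological abelian group is given by a group \<open>G\<close> together with a topology \<open>T\<close> whose
  underlying set is \<open>carrier G\<close>. Functions on the group are total functions of type
  \<open>'a \<Rightarrow> complex\<close> that are \<open>undefined\<close> outside the underlying set, so that equality
  of such functions is equality on the group.
\<close>

definition bounded_cts :: "'a topology \<Rightarrow> ('a \<Rightarrow> complex) set" where
  "bounded_cts T =
     {\<phi> \<in> extensional (topspace T). continuous_map T euclidean \<phi> \<and> bounded (\<phi> ` topspace T)}"

text \<open>
  A single compact set suffices in the basic neighbourhoods because finite unions of compact
  sets are compact.
\<close>

definition ucc_topology :: "'a topology \<Rightarrow> ('a \<Rightarrow> complex) topology" where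
  "ucc_topology T = topology (\<lambda>U. U \<subseteq> bounded_cts T \<and>
     (\<forall>\<phi>\<in>U. \<exists>K \<epsilon>. compactin T K \<and> \<epsilon> > 0 \<and>
        {\<psi> \<in> bounded_cts T. \<forall>x\<in>K. dist (\<psi> x) (\<phi> x) < \<epsilon>} \<subseteq> U))"

lemma openin_ucc_topology:
  "openin (ucc_topology T) U \<longleftrightarrow> U \<subseteq> bounded_cts T \<and>
     (\<forall>\<phi>\<in>U. \<exists>K \<epsilon>. compactin T K \<and> \<epsilon> > 0 \<and>
        {\<psi> \<in> bounded_cts T. \<forall>x\<in>K. dist (\<psi> x) (\<phi> x) < \<epsilon>} \<subseteq> U)"
proof -
  define N where "N \<phi> K \<epsilon> = {\<psi> \<in> bounded_cts T. \<forall>x\<in>K. dist (\<psi> x) (\<phi> x) < \<epsilon>}"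
    for \<phi> :: "'a \<Rightarrow> complex" and K \<epsilon>
  define P where "P U \<longleftrightarrow> U \<subseteq> bounded_cts T \<and>
     (\<forall>\<phi>\<in>U. \<exists>K \<epsilon>. compactin T K \<and> \<epsilon> > 0 \<and> N \<phi> K \<epsilon> \<subseteq> U)" for U
  have inter: "P (U \<inter> V)" if U: "P U" and V: "P V" for U V
    unfolding P_def
  proof (intro conjI ballI)
    show "U \<inter> V \<subseteq> bounded_cts T" using U by (auto simp: P_def)
    fix \<phi> assume "\<phi> \<in> U \<inter> V"
    then obtain K \<epsilon> L \<delta> where
      "compactin T K" "\<epsilon> > 0" "N \<phi> K \<epsilon> \<subseteq> U" "compactin T L" "\<delta> > 0" "N \<phi> L \<delta> \<subseteq> V"
      using U V unfolding P_def by (meson IntD1 IntD2)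
    moreover have "N \<phi> (K \<union> L) (min \<epsilon> \<delta>) \<subseteq> N \<phi> K \<epsilon> \<inter> N \<phi> L \<delta>"
      by (auto simp: N_def)
    ultimately show "\<exists>K \<epsilon>. compactin T K \<and> \<epsilon> > 0 \<and> N \<phi> K \<epsilon> \<subseteq> U \<inter> V"
      by (intro exI[of _ "K \<union> L"] exI[of _ "min \<epsilon> \<delta>"]) (auto intro: compactin_Un)
  qed
  have union: "P (\<Union>\<U>)" if "\<forall>U\<in>\<U>. P U" for \<U>
    unfolding P_def
  proof (intro conjI ballI)
    show "\<Union>\<U> \<subseteq> bounded_cts T" using that by (auto simp: P_def)
    fix \<phi> assume "\<phi> \<in> \<Union>\<U>"
    then obtain U where U: "U \<in> \<U>" "\<phi> \<in> U" by blast
    from that U(1) have "P U" by blast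
    then have "\<exists>K \<epsilon>. compactin T K \<and> \<epsilon> > 0 \<and> N \<phi> K \<epsilon> \<subseteq> U"
      using U(2) by (simp add: P_def)
    moreover have "U \<subseteq> \<Union>\<U>" using U(1) by (rule Union_upper)
    ultimately show "\<exists>K \<epsilon>. compactin T K \<and> \<epsilon> > 0 \<and> N \<phi> K \<epsilon> \<subseteq> \<Union>\<U>"
      by (meson order_trans)
  qed
  have "istopology P"
    unfolding istopology_def
  proof (intro conjI allI impI)
    fix U V assume "P U" "P V" then show "P (U \<inter> V)" by (rule inter)
  next
    fix \<U> assume "\<forall>U\<in>\<U>. P U" then show "P (\<Union>\<U>)" by (rule union)
  qed
  then have "openin (topology P) = P"
    by (rule topology_inverse')
  moreover have "ucc_topology T = topology P"
    by (simp only: ucc_topology_def P_def[abs_def] N_def)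
  ultimately show ?thesis
    by (simp only: P_def N_def)
qed

lemma topspace_ucc_topology [simp]: "topspace (ucc_topology T) = bounded_cts T"
proof (rule antisym)
  show "topspace (ucc_topology T) \<subseteq> bounded_cts T"
    using openin_topspace[of "ucc_topology T"] unfolding openin_ucc_topology by blast
  have "openin (ucc_topology T) (bounded_cts T)"
    unfolding openin_ucc_topology
    by (auto intro!: exI[of _ "{}"] exI[of _ "1::real"])
  then show "bounded_cts T \<subseteq> topspace (ucc_topology T)"
    by (rule openin_subset)
qed

definition cosine_class :: "('a, 'b) monoid_scheme \<Rightarrow> 'a topology \<Rightarrow> ('a \<Rightarrow> complex) set" where
  "cosine_class G T = {\<phi> \<in> bounded_cts T.
     (\<exists>x\<in>carrier G. \<phi> x \<noteq> 0) \<and>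
     (\<forall>x\<in>carrier G. \<forall>y\<in>carrier G.
        \<phi> x * \<phi> y = (\<phi> (x \<otimes>\<^bsub>G\<^esub> y) + \<phi> (x \<otimes>\<^bsub>G\<^esub> inv\<^bsub>G\<^esub> y)) / 2)}"

definition cosine_topology :: "('a, 'b) monoid_scheme \<Rightarrow> 'a topology \<Rightarrow> ('a \<Rightarrow> complex) topology" where
  "cosine_topology G T = subtopology (ucc_topology T) (cosine_class G T)"

lemma topspace_cosine_topology [simp]: "topspace (cosine_topology G T) = cosine_class G T"
  by (auto simp: cosine_topology_def cosine_class_def)


section \<open>The circle group as the quotient of the reals by the integers\<close>

definition real_add_group :: "real monoid" where
  "real_add_group = \<lparr>carrier = UNIV, monoid.mult = (+), one = 0\<rparr>"

definition circle_group :: "real set monoid" where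
  "circle_group = real_add_group Mod \<int>"

definition circle_proj :: "real \<Rightarrow> real set" where
  "circle_proj x = \<int> #>\<^bsub>real_add_group\<^esub> x"

text \<open>The quotient topology.\<close>

definition circle_topology :: "real set topology" where
  "circle_topology = topology (\<lambda>U. U \<subseteq> carrier circle_group \<and> open (circle_proj -` U))"

lemma comm_group_real_add_group: "comm_group real_add_group"
proof (rule comm_groupI)
  fix x assume "x \<in> carrier real_add_group"
  show "\<exists>y\<in>carrier real_add_group. y \<otimes>\<^bsub>real_add_group\<^esub> x = \<one>\<^bsub>real_add_group\<^esub>"
    by (rule bexI[of _ "-x"]) (simp_all add: real_add_group_def)
qed (auto simp: real_add_group_def)

lemma inv_real_add_group [simp]: "inv\<^bsub>real_add_group\<^esub> x = - x"
  using comm_group_real_add_group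
  by (intro group.inv_equality) (auto simp: comm_group_def real_add_group_def)

lemma subgroup_Ints: "subgroup \<int> real_add_group"
  using comm_group_real_add_group
  by (intro group.subgroupI) (auto simp: comm_group_def, auto simp: real_add_group_def)

lemma comm_group_circle_group: "comm_group circle_group"
  unfolding circle_group_def
  by (intro comm_group.abelian_FactGroup comm_group_real_add_group subgroup_Ints)

lemma carrier_circle_group: "carrier circle_group = range circle_proj"
  by (auto simp: circle_group_def FactGroup_def RCOSETS_def circle_proj_def real_add_group_def)

lemma mem_circle_proj: "y \<in> circle_proj x \<longleftrightarrow> y - x \<in> \<int>"
  by (force simp: circle_proj_def r_coset_def real_add_group_def)

lemma openin_circle_topology:
  "openin circle_topology U \<longleftrightarrow> U \<subseteq> carrier circle_group \<and> open (circle_proj -` U)"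
proof -
  have "istopology (\<lambda>U. U \<subseteq> carrier circle_group \<and> open (circle_proj -` U))"
    unfolding istopology_def by (auto simp: vimage_Union)
  then show ?thesis
    by (simp add: circle_topology_def)
qed

lemma topspace_circle_topology [simp]: "topspace circle_topology = carrier circle_group"
proof (rule antisym)
  show "topspace circle_topology \<subseteq> carrier circle_group"
    using openin_topspace[of circle_topology] unfolding openin_circle_topology by blast
  have "circle_proj -` carrier circle_group = UNIV"
    by (auto simp: carrier_circle_group)
  then have "openin circle_topology (carrier circle_group)"
    unfolding openin_circle_topology by simp
  then show "carrier circle_group \<subseteq> topspace circle_topology"
    by (rule openin_subset)
qed


section \<open>The cosine functions and the maps to their indices\<close>

text \<open>
  The function \<open>x \<mapsto> cos (2 \<pi> k x)\<close> has period one, hence takes a single value on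
  each coset of the integers.
\<close>

definition circle_cosine :: "nat \<Rightarrow> real set \<Rightarrow> complex" where
  "circle_cosine k = (\<lambda>X\<in>carrier circle_group.
     the_elem ((\<lambda>x. complex_of_real (cos (2 * pi * real k * x))) ` X))"

lemma circle_cosine_proj:
  "circle_cosine k (circle_proj x) = complex_of_real (cos (2 * pi * real k * x))"
proof -
  have "cos (2 * pi * real k * y) = cos (2 * pi * real k * x)" if "y \<in> circle_proj x" for y
  proof -
    from that obtain m where m: "y = x + of_int m"
      unfolding mem_circle_proj by (metis Ints_cases add_diff_cancel_left' add.commute diff_add_cancel)
    define t where "t = 2 * pi * real k * x"
    have "2 * pi * real k * y = t + 2 * pi * of_int (int k * m)"
      by (simp add: m t_def algebra_simps)
    then have "cos (2 * pi * real k * y) = cos (t + 2 * pi * of_int (int k * m))"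
      by (rule arg_cong)
    also have "\<dots> = cos t"
      unfolding cos_add cos_int_2pin sin_int_2pin by simp
    finally show ?thesis unfolding t_def .
  qed
  moreover have "x \<in> circle_proj x"
    by (simp add: mem_circle_proj)
  ultimately have image: "(\<lambda>x. complex_of_real (cos (2 * pi * real k * x))) ` circle_proj x
      = {complex_of_real (cos (2 * pi * real k * x))}"
    by (metis (no_types, lifting) image_cong image_constant)
  have "circle_proj x \<in> carrier circle_group"
    unfolding carrier_circle_group by (rule rangeI)
  then show ?thesis
    unfolding circle_cosine_def image restrict_def by (simp only: if_True image the_elem_eq)
qed

definition circle_index :: "(real set \<Rightarrow> complex) \<Rightarrow> nat" where
  "circle_index \<phi> = (THE k. \<phi> = circle_cosine k)"

definition cyclic_topology :: "nat \<Rightarrow> int topology" where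
  "cyclic_topology n = discrete_topology (carrier (integer_mod_group n))"

definition cyclic_cosine :: "nat \<Rightarrow> nat \<Rightarrow> int \<Rightarrow> complex" where
  "cyclic_cosine n l = (\<lambda>k\<in>carrier (integer_mod_group n).
     complex_of_real (cos (2 * pi * real l * of_int k / real n)))"

definition cyclic_index_set :: "nat \<Rightarrow> nat set" where
  "cyclic_index_set n = {..<nat \<lceil>(real n + 1) / 2\<rceil>}"

definition cyclic_index :: "nat \<Rightarrow> (int \<Rightarrow> complex) \<Rightarrow> nat" where
  "cyclic_index n \<phi> = (THE l. l \<in> cyclic_index_set n \<and> \<phi> = cyclic_cosine n l)"

end

theory Submission
  imports Defs
begin

text \<open>
  The theorem has an algebraic half, which determines the solutions of d'Alembert's equation
  \<open>\<phi> x * \<phi> y = (\<phi> (x + y) + \<phi> (x - y)) / 2\<close> on both groups, and a topological half, which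
  says that the cosine class of a compact group is discrete.

  \<^bold>\<open>Algebra.\<close> Along the multiples of a single element \<open>y\<close>, d'Alembert's equation is the recursion
  of the Chebyshev polynomials, so \<open>\<phi> (k y) = cos (k z)\<close> for any complex \<open>z\<close> with
  \<open>cos z = \<phi> y\<close> (\<open>dAlembert_int_eq_cos\<close>). If \<open>n y = 0\<close>, then \<open>cos (n z) = 1\<close>, which forces
  \<open>z = 2 \<pi> m / n\<close>; since the cosine is even and periodic, \<open>m\<close> can be taken between \<open>0\<close> and
  \<open>n / 2\<close> (\<open>dAlembert_periodic_eq_cos\<close>). For \<open>y = 1\<close> this is the classification on the cyclic
  group. On the circle it describes \<open>\<phi>\<close> on the multiples of \<open>1 / 2 ^ q\<close> for each \<open>q\<close>, with a
  frequency that might depend on \<open>q\<close>. Continuity at \<open>0\<close> makes \<open>\<phi> (1 / 2 ^ q)\<close> close to \<open>1\<close> for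
  all large \<open>q\<close>, so the half-angle formula has no sign ambiguity there and the frequency does
  not depend on \<open>q\<close>; by density of the dyadic rationals \<open>\<phi>\<close> is a cosine
  (\<open>dAlembert_real_eq_cos\<close>). Distinct admissible frequencies give distinct functions because
  the cosine is injective on \<open>[0, \<pi>]\<close>.

  \<^bold>\<open>Topology.\<close> Two distinct members \<open>\<phi>, \<psi>\<close> of the cosine class of any group differ by at least
  \<open>1 / 10\<close> at some point (\<open>cosine_class_separated\<close>). Indeed \<open>\<phi> (2 x)\<close> and \<open>\<phi> (3 x)\<close> are the
  Chebyshev polynomials \<open>2 u\<^sup>2 - 1\<close> and \<open>4 u\<^sup>3 - 3 u\<close> of \<open>u = \<phi> x\<close>, and at every point at least
  one of these two has a derivative of modulus greater than \<open>1\<close>. So a small nonzero difference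
  at \<open>x\<close> gets larger by a constant factor at \<open>2 x\<close> or at \<open>3 x\<close>, and this cannot go on forever.
  If the group is compact, uniform convergence on the whole group is available, and the cosine
  class is discrete (\<open>cosine_topology_compact\<close>). Since the index maps are bijections between
  discrete spaces, they are homeomorphisms.
\<close>

section \<open>The cosine class of a compact group is discrete\<close>

lemma cosine_class_dAlembert:
  assumes "\<phi> \<in> cosine_class G T" "x \<in> carrier G" "y \<in> carrier G"
  shows "\<phi> x * \<phi> y = (\<phi> (x \<otimes>\<^bsub>G\<^esub> y) + \<phi> (x \<otimes>\<^bsub>G\<^esub> inv\<^bsub>G\<^esub> y)) / 2"
  using assms unfolding cosine_class_def by blast

lemma cosine_class_one:
  assumes "group G" "\<phi> \<in> cosine_class G T"
  shows "\<phi> \<one>\<^bsub>G\<^esub> = 1"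
proof -
  interpret group G by fact
  obtain x where x: "x \<in> carrier G" "\<phi> x \<noteq> 0"
    using assms(2) by (auto simp: cosine_class_def)
  have "\<phi> x * \<phi> \<one>\<^bsub>G\<^esub> = \<phi> x"
    using cosine_class_dAlembert[OF assms(2) x(1), of "\<one>\<^bsub>G\<^esub>"] x(1) by simp
  then show ?thesis
    using x by simp
qed

lemma cosine_class_double:
  assumes "group G" "\<phi> \<in> cosine_class G T" and x: "x \<in> carrier G"
  shows "\<phi> (x \<otimes>\<^bsub>G\<^esub> x) = 2 * \<phi> x ^ 2 - 1"
proof -
  interpret group G by fact
  have "\<phi> x * \<phi> x = (\<phi> (x \<otimes>\<^bsub>G\<^esub> x) + \<phi> (x \<otimes>\<^bsub>G\<^esub> inv\<^bsub>G\<^esub> x)) / 2"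
    by (rule cosine_class_dAlembert[OF assms(2) x x])
  then show ?thesis
    using x cosine_class_one[OF assms(1,2)] by (simp add: power2_eq_square field_simps)
qed

lemma cosine_class_triple:
  assumes "group G" "\<phi> \<in> cosine_class G T" and x: "x \<in> carrier G"
  shows "\<phi> (x \<otimes>\<^bsub>G\<^esub> x \<otimes>\<^bsub>G\<^esub> x) = 4 * \<phi> x ^ 3 - 3 * \<phi> x"
proof -
  interpret group G by fact
  have "x \<otimes>\<^bsub>G\<^esub> x \<otimes>\<^bsub>G\<^esub> inv\<^bsub>G\<^esub> x = x"
    using x by (simp add: m_assoc)
  moreover have "\<phi> (x \<otimes>\<^bsub>G\<^esub> x) * \<phi> x
      = (\<phi> (x \<otimes>\<^bsub>G\<^esub> x \<otimes>\<^bsub>G\<^esub> x) + \<phi> (x \<otimes>\<^bsub>G\<^esub> x \<otimes>\<^bsub>G\<^esub> inv\<^bsub>G\<^esub> x)) / 2"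
    using x by (intro cosine_class_dAlembert[OF assms(2)]) auto
  ultimately have "\<phi> (x \<otimes>\<^bsub>G\<^esub> x \<otimes>\<^bsub>G\<^esub> x) = 2 * (2 * \<phi> x ^ 2 - 1) * \<phi> x - \<phi> x"
    using cosine_class_double[OF assms] by (simp add: field_simps)
  then show ?thesis
    by (simp add: algebra_simps power2_eq_square power3_eq_cube)
qed

text \<open>
  The derivatives of the two polynomials are \<open>4 u\<close> and \<open>12 u\<^sup>2 - 3\<close>. The first is large away from
  \<open>0\<close> and the second is close to \<open>-3\<close> near \<open>0\<close>. The threshold \<open>7 / 20\<close> for \<open>norm u\<close> is chosen
  so that in each range the corresponding divided difference still has modulus above \<open>21 / 20\<close>.
\<close>

lemma Chebyshev_2_3_expansion:
  fixes u v :: complex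
  assumes "norm (v - u) < 1 / 10"
  shows "21 / 20 * norm (v - u) \<le> norm ((2 * v ^ 2 - 1) - (2 * u ^ 2 - 1)) \<or>
         21 / 20 * norm (v - u) \<le> norm ((4 * v ^ 3 - 3 * v) - (4 * u ^ 3 - 3 * u))"
proof (cases "norm u \<ge> 7 / 20")
  case True
  have "norm (2 * u) \<le> norm (v + u) + norm (v - u)"
    using norm_triangle_ineq4[of "v + u" "v - u"] by simp
  moreover have "norm (2 * u) = 2 * norm u" "norm (2 * (v + u)) = 2 * norm (v + u)"
    by (simp_all only: norm_mult norm_numeral)
  ultimately have "norm (2 * (v + u)) \<ge> 21 / 20"
    using True assms by argo
  then have "21 / 20 * norm (v - u) \<le> norm (2 * (v + u)) * norm (v - u)"
    by (intro mult_right_mono) auto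
  also have "\<dots> = norm ((2 * v ^ 2 - 1) - (2 * u ^ 2 - 1))"
    unfolding norm_mult[symmetric] by (rule arg_cong[of _ _ norm]) (simp add: algebra_simps power2_eq_square)
  finally show ?thesis ..
next
  case False
  have v: "norm v \<le> 9 / 20"
    using False assms norm_triangle_ineq[of u "v - u"] by simp
  have "norm (u ^ 2 + u * v + v ^ 2) \<le> norm u * norm u + norm u * norm v + norm v * norm v"
    unfolding power2_eq_square norm_mult[symmetric]
    by (intro norm_triangle_le add_mono order_refl)
  also have "\<dots> \<le> 7 / 20 * (7 / 20) + 7 / 20 * (9 / 20) + 9 / 20 * (9 / 20)"
    using False v by (intro add_mono mult_mono) auto
  finally have s: "norm (4 * (u ^ 2 + u * v + v ^ 2)) \<le> 193 / 100"
    unfolding norm_mult by simp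
  have "norm (3 :: complex) \<le> norm (4 * (u ^ 2 + u * v + v ^ 2) - 3)
          + norm (4 * (u ^ 2 + u * v + v ^ 2))"
    using norm_triangle_ineq4[of "4 * (u ^ 2 + u * v + v ^ 2)" "4 * (u ^ 2 + u * v + v ^ 2) - 3"]
    by simp
  then have "21 / 20 \<le> norm (4 * (u ^ 2 + u * v + v ^ 2) - 3)"
    using s by simp
  then have "21 / 20 * norm (v - u) \<le> norm (4 * (u ^ 2 + u * v + v ^ 2) - 3) * norm (v - u)"
    by (intro mult_right_mono) auto
  also have "\<dots> = norm ((4 * v ^ 3 - 3 * v) - (4 * u ^ 3 - 3 * u))"
    unfolding norm_mult[symmetric]
    by (rule arg_cong[of _ _ norm]) (simp add: algebra_simps power2_eq_square power3_eq_cube)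
  finally show ?thesis ..
qed

text \<open>
  If the two functions stayed within \<open>1 / 10\<close> of each other, doubling and tripling the argument
  would enlarge a nonzero difference by the factor \<open>21 / 20\<close> again and again.
\<close>

lemma cosine_class_separated:
  assumes G: "group G" and \<phi>: "\<phi> \<in> cosine_class G T" and \<psi>: "\<psi> \<in> cosine_class G T"
    and x0: "x0 \<in> carrier G" "\<phi> x0 \<noteq> \<psi> x0"
  shows "\<exists>x\<in>carrier G. dist (\<psi> x) (\<phi> x) \<ge> 1 / 10"
proof (rule ccontr)
  assume "\<not> ?thesis"
  then have small: "norm (\<psi> x - \<phi> x) < 1 / 10" if "x \<in> carrier G" for x
    using that by (auto simp: dist_norm not_le)
  interpret group G by fact
  define d where "d = norm (\<psi> x0 - \<phi> x0)"
  have "d > 0"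
    using x0 by (auto simp: d_def)
  have "\<exists>x\<in>carrier G. (21 / 20) ^ n * d \<le> norm (\<psi> x - \<phi> x)" for n
  proof (induction n)
    case 0
    show ?case
      using x0 by (auto simp: d_def)
  next
    case (Suc n)
    then obtain x where x: "x \<in> carrier G" "(21 / 20) ^ n * d \<le> norm (\<psi> x - \<phi> x)"
      by blast
    have "\<exists>y\<in>carrier G. 21 / 20 * norm (\<psi> x - \<phi> x) \<le> norm (\<psi> y - \<phi> y)"
      using Chebyshev_2_3_expansion[OF small[OF x(1)]] x(1)
      by (metis cosine_class_double[OF G \<phi> x(1)] cosine_class_double[OF G \<psi> x(1)]
          cosine_class_triple[OF G \<phi> x(1)] cosine_class_triple[OF G \<psi> x(1)] m_closed)
    moreover have "(21 / 20) ^ Suc n * d \<le> 21 / 20 * norm (\<psi> x - \<phi> x)"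
      unfolding power_Suc mult.assoc using x(2) by (intro mult_left_mono) auto
    ultimately show ?case
      by (meson order_trans)
  qed
  moreover obtain n where "1 / (10 * d) < (21 / 20 :: real) ^ n"
    using real_arch_pow[of "21 / 20"] by auto
  then have "1 / 10 < (21 / 20) ^ n * d"
    using \<open>d > 0\<close> by (simp add: field_simps)
  ultimately obtain x where "x \<in> carrier G" "1 / 10 < norm (\<psi> x - \<phi> x)"
    by (meson order_less_le_trans)
  then show False
    using small[of x] by simp
qed

text \<open>
  Over a compact set, the bound \<open>\<delta> < \<epsilon>\<close> leaves the room \<open>\<epsilon> - \<delta>\<close> for perturbations. The set
  defined by the pointwise condition \<open>dist (\<psi> x) (\<phi> x) < \<epsilon>\<close> lacks a uniform margin in general,
  since \<open>\<phi>\<close> is an arbitrary function here.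
\<close>

lemma openin_ucc_ball:
  assumes "compactin T K"
  shows "openin (ucc_topology T) {\<psi> \<in> bounded_cts T. \<exists>\<delta><\<epsilon>. \<forall>x\<in>K. dist (\<psi> x) (\<phi> x) \<le> \<delta>}"
    (is "openin _ ?U")
  unfolding openin_ucc_topology
proof (intro conjI ballI)
  show "?U \<subseteq> bounded_cts T"
    by auto
  fix \<psi> assume "\<psi> \<in> ?U"
  then obtain \<delta> where \<delta>: "\<delta> < \<epsilon>" "\<And>x. x \<in> K \<Longrightarrow> dist (\<psi> x) (\<phi> x) \<le> \<delta>"
    by auto
  have "\<rho> \<in> ?U" if \<rho>: "\<rho> \<in> bounded_cts T" "\<forall>x\<in>K. dist (\<rho> x) (\<psi> x) < (\<epsilon> - \<delta>) / 2" for \<rho>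
  proof -
    have "dist (\<rho> x) (\<phi> x) \<le> (\<epsilon> + \<delta>) / 2" if "x \<in> K" for x
    proof -
      have "dist (\<rho> x) (\<psi> x) < (\<epsilon> - \<delta>) / 2"
        using \<rho>(2) that by blast
      then show ?thesis
        using \<delta>(2)[OF that] dist_triangle[of "\<rho> x" "\<phi> x" "\<psi> x"] by argo
    qed
    moreover have "(\<epsilon> + \<delta>) / 2 < \<epsilon>"
      using \<delta>(1) by simp
    ultimately show ?thesis
      using \<rho>(1) by blast
  qed
  then show "\<exists>K \<epsilon>'. compactin T K \<and> \<epsilon>' > 0 \<and> {\<rho> \<in> bounded_cts T. \<forall>x\<in>K. dist (\<rho> x) (\<psi> x) < \<epsilon>'} \<subseteq> ?U"
    using assms \<delta>(1) by (intro exI[of _ K] exI[of _ "(\<epsilon> - \<delta>) / 2"]) auto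
qed

text \<open>
  The uniform ball of radius \<open>1 / 10\<close> around a member of the class is open by compactness and, by
  the separation above, contains no other member.
\<close>

lemma cosine_topology_compact:
  assumes G: "group G" and T: "topspace T = carrier G" and "compact_space T"
  shows "cosine_topology G T = discrete_topology (cosine_class G T)"
proof -
  have "openin (cosine_topology G T) {\<phi>}" if \<phi>: "\<phi> \<in> cosine_class G T" for \<phi>
  proof -
    define U where "U = {\<psi> \<in> bounded_cts T. \<exists>\<delta><1/10. \<forall>x\<in>carrier G. dist (\<psi> x) (\<phi> x) \<le> \<delta>}"
    have "openin (ucc_topology T) U"
      unfolding U_def using assms by (intro openin_ucc_ball) (simp add: compact_space_def)
    moreover have "{\<phi>} = U \<inter> cosine_class G T"
    proof (intro antisym subsetI)
      fix \<psi> assume "\<psi> \<in> {\<phi>}"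
      then show "\<psi> \<in> U \<inter> cosine_class G T"
        using \<phi> by (auto simp: U_def cosine_class_def intro!: exI[of _ 0])
    next
      fix \<psi> assume \<psi>: "\<psi> \<in> U \<inter> cosine_class G T"
      then have "\<phi> x = \<psi> x" if "x \<in> carrier G" for x
        using cosine_class_separated[OF G \<phi> _ that, of \<psi>] by (fastforce simp: U_def)
      moreover have "\<phi> \<in> extensional (carrier G)" "\<psi> \<in> extensional (carrier G)"
        using \<phi> \<psi> T by (auto simp: cosine_class_def bounded_cts_def)
      ultimately have "\<phi> = \<psi>"
        by (metis extensionalityI)
      then show "\<psi> \<in> {\<phi>}"
        by simp
    qed
    ultimately show ?thesis
      unfolding cosine_topology_def openin_subtopology by blast
  qed
  then show ?thesis
    by (metis discrete_topology_unique topspace_cosine_topology)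
qed

lemma homeomorphic_map_discrete:
  assumes "inj_on f A" "f ` A = B"
  shows "homeomorphic_map (discrete_topology A) (discrete_topology B) f"
  using assms
  by (intro bijective_open_imp_homeomorphic_map) (auto simp: open_map_into_discrete_topology)

section \<open>D'Alembert's equation on the integers\<close>

text \<open>
  With \<open>j = 1\<close> the equation reads \<open>a (i + 1) = 2 * a i * cos z - a (i - 1)\<close>, a recursion of order
  two that \<open>cos (i z)\<close> also satisfies; with \<open>i = 0\<close> it says that \<open>a\<close> is even.
\<close>

lemma dAlembert_int_eq_cos:
  fixes a :: "int \<Rightarrow> complex"
  assumes a: "\<And>i j. a i * a j = (a (i + j) + a (i - j)) / 2" and a0: "a 0 = 1"
    and z: "a 1 = cos z"
  shows "a k = cos (of_int k * z)"
proof -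
  have nat: "a (int n) = cos (of_nat n * z) \<and> a (int (Suc n)) = cos (of_nat (Suc n) * z)" for n
  proof (induction n)
    case 0
    show ?case
      using a0 z by simp
  next
    case (Suc n)
    have "a (int (Suc n)) * a 1 = (a (int (Suc (Suc n))) + a (int n)) / 2"
      using a[of "int (Suc n)" 1] by (simp add: algebra_simps)
    moreover have "cos (of_nat (Suc n) * z) * cos z
        = (cos (of_nat n * z) + cos (of_nat (Suc (Suc n)) * z)) / 2"
      unfolding cos_times_cos by (simp add: algebra_simps)
    ultimately show ?case
      using Suc z by (simp add: field_simps)
  qed
  have even: "a (- j) = a j" for j
    using a[of 0 j] a0 by simp
  show ?thesis
  proof (cases k)
    case (nonneg n)
    then show ?thesis
      using nat[of n] by simp
  next
    case (neg n)
    then show ?thesis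
      using nat[of n] even[of "int (Suc n)"] by (metis cos_minus mult_minus_left of_int_minus of_int_of_nat_eq)
  qed
qed

lemma cos_add_int_2pi: "cos (t + 2 * pi * of_int i) = cos (t :: real)"
  unfolding cos_add cos_int_2pin sin_int_2pin by simp

text \<open>
  On the integers, the frequencies \<open>m / n\<close> and \<open>m' / n\<close> are indistinguishable if \<open>m \<equiv> \<plusminus>m'\<close> modulo
  \<open>n\<close>, and every class under this identification has a representative in \<open>[0, n / 2]\<close>.
\<close>

lemma cos_frequency_reduce:
  fixes m :: int and n :: nat
  assumes "n > 0"
  obtains l :: nat where "2 * l \<le> n"
    "\<And>k::int. cos (2 * pi * of_int m * of_int k / real n) = cos (2 * pi * real l * of_int k / real n)"
proof -
  define r where "r = nat (m mod int n)"
  have r: "int r = m mod int n" "r < n"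
    using assms by (auto simp: r_def nat_less_iff)
  have m: "real_of_int m = real n * of_int (m div int n) + real r"
    by (metis mult_div_mod_eq of_int_add of_int_mult of_int_of_nat_eq r(1))
  have mr: "cos (2 * pi * of_int m * of_int k / real n) = cos (2 * pi * real r * of_int k / real n)" for k :: int
  proof -
    have "2 * pi * of_int m * of_int k / real n
        = 2 * pi * real r * of_int k / real n + 2 * pi * of_int (m div int n * k)"
      using assms by (simp add: m field_simps)
    then show ?thesis
      by (simp only: cos_add_int_2pi)
  qed
  show ?thesis
  proof (cases "2 * r \<le> n")
    case True
    then show ?thesis
      using that mr by blast
  next
    case False
    have "cos (2 * pi * of_int m * of_int k / real n) = cos (2 * pi * real (n - r) * of_int k / real n)" for k :: int
    proof -
      have "2 * pi * real (n - r) * of_int k / real n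
          = - (2 * pi * real r * of_int k / real n) + 2 * pi * of_int k"
        using assms r(2) by (simp add: of_nat_diff field_simps)
      then show ?thesis
        by (simp only: cos_add_int_2pi mr cos_minus)
    qed
    then show ?thesis
      using that[of "n - r"] False by simp
  qed
qed

text \<open>
  The complex cosine is surjective, so an angle \<open>z\<close> with \<open>cos z = a 1\<close> always exists. It need not
  be real a priori; \<open>cos (n z) = 1\<close> has only real solutions, which are multiples of \<open>2 \<pi> / n\<close>.
\<close>

lemma dAlembert_periodic_eq_cos:
  fixes a :: "int \<Rightarrow> complex"
  assumes a: "\<And>i j. a i * a j = (a (i + j) + a (i - j)) / 2" and a0: "a 0 = 1"
    and n: "n > 0" "a (int n) = 1"
  obtains l :: nat where "2 * l \<le> n"
    "\<And>k. a k = complex_of_real (cos (2 * pi * real l * of_int k / real n))"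
proof -
  define z where "z = Arccos (a 1)"
  have ak: "a k = cos (of_int k * z)" for k
    by (rule dAlembert_int_eq_cos[OF a a0]) (simp add: z_def)
  then have "cos (of_nat n * z) = 1"
    using n(2) by (metis of_int_of_nat_eq)
  then obtain m :: int where m: "of_nat n * z = complex_of_real (2 * real_of_int m * pi)"
    unfolding cos_eq_1 by blast
  then have "z = complex_of_real (2 * pi * of_int m / real n)"
    using n(1) by (simp add: field_simps)
  then have "a k = complex_of_real (cos (2 * pi * of_int m * of_int k / real n))" for k
    unfolding ak cos_of_real[symmetric] by (simp add: algebra_simps)
  moreover obtain l where "2 * l \<le> n"
    "\<And>k::int. cos (2 * pi * of_int m * of_int k / real n) = cos (2 * pi * real l * of_int k / real n)"
    using cos_frequency_reduce[OF n(1), of m] by blast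
  ultimately show ?thesis
    using that by simp
qed

section \<open>The cyclic groups\<close>

lemma mem_cyclic_index_set: "l \<in> cyclic_index_set n \<longleftrightarrow> 2 * l \<le> n"
  unfolding cyclic_index_set_def lessThan_iff zless_nat_eq_int_zless less_ceiling_iff by auto

lemma cyclic_cosine_mod:
  assumes "n > 0"
  shows "cyclic_cosine n l (k mod int n) = complex_of_real (cos (2 * pi * real l * of_int k / real n))"
proof -
  have k: "real_of_int k = real n * of_int (k div int n) + of_int (k mod int n)"
    by (metis mult_div_mod_eq of_int_add of_int_mult of_int_of_nat_eq)
  have "2 * pi * real l * of_int k / real n
      = 2 * pi * real l * of_int (k mod int n) / real n + 2 * pi * of_int (int l * (k div int n))"
    using assms by (simp add: k field_simps)
  then have "cos (2 * pi * real l * of_int k / real n) = cos (2 * pi * real l * of_int (k mod int n) / real n)"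
    by (simp only: cos_add_int_2pi)
  then show ?thesis
    using assms by (simp add: cyclic_cosine_def carrier_integer_mod_group)
qed

lemma cyclic_cosine_in_cosine_class:
  assumes n: "n > 0"
  shows "cyclic_cosine n l \<in> cosine_class (integer_mod_group n) (cyclic_topology n)"
proof -
  let ?c = "cyclic_cosine n l"
  have "finite (carrier (integer_mod_group n))"
    using n by (simp add: carrier_integer_mod_group)
  then have "?c \<in> bounded_cts (cyclic_topology n)"
    by (auto simp: bounded_cts_def cyclic_topology_def cyclic_cosine_def intro: finite_imp_bounded)
  moreover have "?c 0 \<noteq> 0"
    using cyclic_cosine_mod[OF n, of l 0] by simp
  moreover have "?c x * ?c y = (?c ((x + y) mod int n) + ?c ((x + (- y) mod int n) mod int n)) / 2"
    if "x \<in> carrier (integer_mod_group n)" "y \<in> carrier (integer_mod_group n)" for x y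
  proof -
    have "?c x * ?c y = ?c (x mod int n) * ?c (y mod int n)"
      using that n by (simp add: carrier_integer_mod_group)
    also have "\<dots> = (?c ((x + y) mod int n) + ?c ((x - y) mod int n)) / 2"
      unfolding cyclic_cosine_mod[OF n] of_real_mult[symmetric] cos_times_cos
      by (simp add: algebra_simps diff_divide_distrib add_divide_distrib)
    finally show ?thesis
      by (simp add: mod_simps)
  qed
  ultimately show ?thesis
    unfolding cosine_class_def using integer_mod_group_0 by auto
qed

lemma cosine_class_cyclic:
  assumes n: "n > 0"
  shows "cosine_class (integer_mod_group n) (cyclic_topology n)
    = cyclic_cosine n ` cyclic_index_set n"
proof (intro antisym subsetI)
  fix \<phi> assume \<phi>: "\<phi> \<in> cosine_class (integer_mod_group n) (cyclic_topology n)"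
  define a where "a k = \<phi> (k mod int n)" for k
  have a: "a i * a j = (a (i + j) + a (i - j)) / 2" for i j
  proof -
    have mem: "k mod int n \<in> carrier (integer_mod_group n)" for k
      using n by (simp add: carrier_integer_mod_group)
    have "a i * a j = (\<phi> ((i mod int n + j mod int n) mod int n)
          + \<phi> ((i mod int n + (- (j mod int n)) mod int n) mod int n)) / 2"
      using cosine_class_dAlembert[OF \<phi> mem[of i] mem[of j]] mem[of j] by (simp add: a_def)
    then show ?thesis
      by (simp add: a_def mod_simps)
  qed
  have "a 0 = 1" "a (int n) = 1"
    using cosine_class_one[OF group_integer_mod_group \<phi>] by (simp_all add: a_def)
  then obtain l where l: "2 * l \<le> n"
    "\<And>k. a k = complex_of_real (cos (2 * pi * real l * of_int k / real n))"
    using dAlembert_periodic_eq_cos[of a n, OF a _ n] by blast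
  have "\<phi> = cyclic_cosine n l"
  proof (rule extensionalityI)
    show "\<phi> \<in> extensional (carrier (integer_mod_group n))"
      using \<phi> by (simp add: cosine_class_def bounded_cts_def cyclic_topology_def)
    show "cyclic_cosine n l \<in> extensional (carrier (integer_mod_group n))"
      by (simp add: cyclic_cosine_def)
    show "\<phi> k = cyclic_cosine n l k" if "k \<in> carrier (integer_mod_group n)" for k
      using that n l(2)[of k] by (simp add: a_def cyclic_cosine_def carrier_integer_mod_group)
  qed
  then show "\<phi> \<in> cyclic_cosine n ` cyclic_index_set n"
    using l(1) by (simp add: mem_cyclic_index_set)
qed (use cyclic_cosine_in_cosine_class[OF n] in auto)

text \<open>
  The frequency is recovered from the value at the generator, since \<open>2 \<pi> l / n\<close> lies in
  \<open>[0, \<pi>]\<close>. The generator is written \<open>1 mod n\<close> to include the trivial group.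
\<close>

lemma inj_on_cyclic_cosine:
  assumes n: "n > 0"
  shows "inj_on (cyclic_cosine n) (cyclic_index_set n)"
proof (rule inj_onI)
  fix l m assume "l \<in> cyclic_index_set n" "m \<in> cyclic_index_set n"
    and eq: "cyclic_cosine n l = cyclic_cosine n m"
  then have le: "2 * real l \<le> real n" "2 * real m \<le> real n"
    unfolding mem_cyclic_index_set by linarith+
  have "cos (2 * pi * real l / real n) = cos (2 * pi * real m / real n)"
    using arg_cong[OF eq, of "\<lambda>c. c (1 mod int n)"] unfolding cyclic_cosine_mod[OF n] by simp
  moreover have "2 * pi * real l / real n \<le> pi" "2 * pi * real m / real n \<le> pi"
    using n le by (simp_all add: field_simps)
  moreover have "0 \<le> 2 * pi * real l / real n" "0 \<le> 2 * pi * real m / real n"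
    by simp_all
  ultimately have "2 * pi * real l / real n = 2 * pi * real m / real n"
    by (metis cos_inj_pi)
  then show "l = m"
    using n by simp
qed

lemma cyclic_index_cyclic_cosine:
  assumes "n > 0" "l \<in> cyclic_index_set n"
  shows "cyclic_index n (cyclic_cosine n l) = l"
  unfolding cyclic_index_def
  using assms inj_on_cyclic_cosine[OF assms(1)] by (intro the_equality) (auto dest: inj_onD)

section \<open>The circle group\<close>

lemma circle_mult: "circle_proj x \<otimes>\<^bsub>circle_group\<^esub> circle_proj y = circle_proj (x + y)"
proof -
  have "normal \<int> real_add_group"
    using comm_group_real_add_group subgroup_Ints by (simp add: comm_group.subgroup_imp_normal)
  from normal.rcos_sum[OF this, of x y] show ?thesis
    by (simp add: circle_group_def FactGroup_def circle_proj_def real_add_group_def)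
qed

lemma circle_proj_eq_iff: "circle_proj x = circle_proj y \<longleftrightarrow> x - y \<in> \<int>"
proof
  assume "circle_proj x = circle_proj y"
  then show "x - y \<in> \<int>"
    by (metis mem_circle_proj diff_self Ints_0)
next
  assume xy: "x - y \<in> \<int>"
  show "circle_proj x = circle_proj y"
  proof (rule Set.set_eqI)
    fix z
    have "z - x = (z - y) - (x - y)" "z - y = (z - x) + (x - y)"
      by simp_all
    then show "z \<in> circle_proj x \<longleftrightarrow> z \<in> circle_proj y"
      unfolding mem_circle_proj using xy by (metis Ints_add Ints_diff)
  qed
qed

lemma group_circle_group: "group circle_group"
  using comm_group_circle_group by (simp add: comm_group_def)

lemma circle_proj_in_carrier [simp]: "circle_proj x \<in> carrier circle_group"
  by (simp add: carrier_circle_group)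

lemma circle_one: "\<one>\<^bsub>circle_group\<^esub> = circle_proj 0"
  using group.r_cancel_one'[OF group_circle_group, of "circle_proj 0" "circle_proj 0"]
  by (simp add: circle_mult)

lemma circle_inv: "inv\<^bsub>circle_group\<^esub> circle_proj x = circle_proj (- x)"
  by (rule group.inv_equality[OF group_circle_group]) (simp_all add: circle_mult circle_one)

lemma quotient_map_circle_proj: "quotient_map euclidean circle_topology circle_proj"
  unfolding quotient_map_def by (auto simp: carrier_circle_group openin_circle_topology vimage_def)

lemma continuous_map_circle_topology:
  fixes \<phi> :: "real set \<Rightarrow> 'a :: topological_space"
  shows "continuous_map circle_topology euclidean \<phi> \<longleftrightarrow> continuous_on UNIV (\<phi> \<circ> circle_proj)"
  using continuous_compose_quotient_map_eq[OF quotient_map_circle_proj, of euclidean \<phi>] by simp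

lemma compact_space_circle_topology: "compact_space circle_topology"
proof -
  have "circle_proj x \<in> circle_proj ` {0..1}" for x
  proof
    show "circle_proj x = circle_proj (frac x)"
      by (simp add: circle_proj_eq_iff frac_def)
    show "frac x \<in> {0..1}"
      using frac_lt_1[of x] by simp
  qed
  then have "circle_proj ` {0..1} = topspace circle_topology"
    by (auto simp: carrier_circle_group)
  moreover have "compactin circle_topology (circle_proj ` {0..1})"
    by (rule image_compactin[OF _ quotient_imp_continuous_map[OF quotient_map_circle_proj]]) simp
  ultimately show ?thesis
    by (simp add: compact_space_def)
qed

lemma floor_dyadic_tendsto:
  fixes x :: real
  shows "(\<lambda>q. of_int \<lfloor>x * 2 ^ q\<rfloor> / 2 ^ q) \<longlonglongrightarrow> x"
proof (rule Lim_transform_bound[of _ "\<lambda>q. (1 / 2) ^ q", THEN LIM_zero_cancel])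
  show "(\<lambda>q. (1 / 2 :: real) ^ q) \<longlonglongrightarrow> 0"
    by (simp add: LIMSEQ_realpow_zero)
  have "norm (of_int \<lfloor>x * 2 ^ q\<rfloor> / 2 ^ q - x) \<le> norm ((1 / 2 :: real) ^ q)" for q
  proof -
    have "of_int \<lfloor>x * 2 ^ q\<rfloor> / 2 ^ q - x = (of_int \<lfloor>x * 2 ^ q\<rfloor> - x * 2 ^ q) / 2 ^ q"
      by (simp add: field_simps)
    also have "norm \<dots> \<le> 1 / 2 ^ q"
      by (simp add: divide_le_cancel) linarith
    finally show ?thesis
      by (simp add: power_divide)
  qed
  then show "\<forall>\<^sub>F q in sequentially. norm (of_int \<lfloor>x * 2 ^ q\<rfloor> / 2 ^ q - x) \<le> norm ((1 / 2 :: real) ^ q)"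
    by simp
qed

text \<open>
  The values at \<open>0\<close> and \<open>1\<close> give a frequency \<open>m\<close> that is correct on the multiples of one small dyadic step
  \<open>1 / 2 ^ p\<close>. It stays correct when the step is halved: of the two square roots that the
  half-angle formula allows, continuity selects the one with positive real part.
\<close>

lemma dAlembert_real_eq_cos:
  fixes F :: "real \<Rightarrow> complex"
  assumes F: "\<And>x y. F x * F y = (F (x + y) + F (x - y)) / 2" and F0: "F 0 = 1" and F1: "F 1 = 1"
    and cont: "continuous_on UNIV F"
  obtains m :: nat where "\<And>x. F x = complex_of_real (cos (2 * pi * real m * x))"
proof -
  have lim: "(\<lambda>q. F (s q)) \<longlonglongrightarrow> F x" if "s \<longlonglongrightarrow> x" for s x
    using continuous_on_tendsto_compose[OF cont that] by simp
  have "(\<lambda>q. Re (F ((1 / 2) ^ q))) \<longlonglongrightarrow> Re (F 0)"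
    by (intro tendsto_Re lim) (simp add: LIMSEQ_realpow_zero)
  then have "\<forall>\<^sub>F q in sequentially. Re (F ((1 / 2) ^ q)) > 0"
    by (rule order_tendstoD) (simp add: F0)
  then obtain p where pos: "\<And>q. q \<ge> p \<Longrightarrow> Re (F (1 / 2 ^ q)) > 0"
    by (auto simp: eventually_sequentially power_divide)
  obtain m where m: "2 * m \<le> 2 ^ p"
    "\<And>k::int. F (of_int k / 2 ^ p) = complex_of_real (cos (2 * pi * real m * of_int k / real (2 ^ p)))"
  proof (rule dAlembert_periodic_eq_cos[of "\<lambda>k. F (of_int k / 2 ^ p)" "2 ^ p"])
    show "F (of_int i / 2 ^ p) * F (of_int j / 2 ^ p)
        = (F (of_int (i + j) / 2 ^ p) + F (of_int (i - j) / 2 ^ p)) / 2" for i j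
      by (simp add: F add_divide_distrib diff_divide_distrib)
  qed (use F0 F1 in auto)
  define b where "b q = 2 * pi * real m / 2 ^ q" for q :: nat
  have "2 * real m \<le> 2 ^ p"
    using m(1) by (metis of_nat_le_iff of_nat_mult of_nat_numeral of_nat_power)
  then have "2 * real m * pi \<le> 2 ^ p * pi"
    by (rule mult_right_mono) simp
  then have "b p \<le> pi"
    unfolding b_def by (simp add: field_simps)
  have step: "F (1 / 2 ^ (p + i)) = complex_of_real (cos (b (p + i))) \<and> b (p + i) \<le> pi / 2" for i
  proof (induction i)
    case 0
    have eq: "F (1 / 2 ^ p) = complex_of_real (cos (b p))"
      using m(2)[of 1] by (simp add: b_def)
    \<comment> \<open>From \<open>2 m \<le> 2 ^ p\<close> the angle is at most \<open>\<pi>\<close>; positivity of its cosine halves this bound.\<close>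
    have "b p \<le> pi / 2"
    proof (rule ccontr)
      assume "\<not> b p \<le> pi / 2"
      then have "cos (b p) < cos (pi / 2)"
        using \<open>b p \<le> pi\<close> by (intro cos_monotone_0_pi) auto
      then show False
        using pos[of p] eq by simp
    qed
    then show ?case
      using eq by simp
  next
    case (Suc i)
    define y where "y = 1 / (2::real) ^ (p + Suc i)"
    define c where "c = b (p + Suc i)"
    have y: "1 / 2 ^ (p + i) = y + y" and c: "b (p + i) = 2 * c"
      by (simp_all add: y_def c_def b_def)
    have "0 \<le> c" "c \<le> pi / 4"
      using Suc by (simp_all add: c) (simp add: c_def b_def)
    then have "cos c > 0"
      by (intro cos_gt_zero_pi) (use pi_gt_zero in linarith)+
    have "F y ^ 2 = (F (y + y) + 1) / 2"
      using F[of y y] F0 by (simp add: power2_eq_square)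
    also have "\<dots> = complex_of_real (cos c) ^ 2"
      using Suc unfolding y c cos_double_cos by simp
    finally have "F y = complex_of_real (cos c) \<or> F y = - complex_of_real (cos c)"
      by (simp only: power2_eq_iff)
    then have "F y = complex_of_real (cos c)"
      using pos[of "p + Suc i"] \<open>cos c > 0\<close> unfolding y_def[symmetric] by auto
    moreover have "c \<le> pi / 2"
      using \<open>c \<le> pi / 4\<close> pi_ge_zero by linarith
    ultimately show ?case
      unfolding y_def c_def by blast
  qed
  have dyadic: "F (of_int k / 2 ^ q) = complex_of_real (cos (2 * pi * real m * (of_int k / 2 ^ q)))"
    if "q \<ge> p" for q and k :: int
  proof -
    obtain i where q: "q = p + i"
      using \<open>q \<ge> p\<close> le_Suc_ex by blast
    have "F (of_int k / 2 ^ q) = cos (of_int k * complex_of_real (b q))"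
    proof (rule dAlembert_int_eq_cos)
      show "F (of_int i / 2 ^ q) * F (of_int j / 2 ^ q)
          = (F (of_int (i + j) / 2 ^ q) + F (of_int (i - j) / 2 ^ q)) / 2" for i j
        by (simp add: F add_divide_distrib diff_divide_distrib)
    qed (use F0 step[of i] q in \<open>auto simp: cos_of_real\<close>)
    also have "\<dots> = complex_of_real (cos (of_int k * b q))"
      by (metis cos_of_real of_real_mult of_real_of_int_eq)
    finally show ?thesis
      by (simp add: b_def mult_ac)
  qed
  have "F x = complex_of_real (cos (2 * pi * real m * x))" for x
  proof (rule LIMSEQ_unique)
    let ?s = "\<lambda>q. of_int \<lfloor>x * 2 ^ q\<rfloor> / 2 ^ q :: real"
    show "(\<lambda>q. F (?s q)) \<longlonglongrightarrow> F x"
      by (rule lim[OF floor_dyadic_tendsto])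
    have "(\<lambda>q. complex_of_real (cos (2 * pi * real m * ?s q)))
        \<longlonglongrightarrow> complex_of_real (cos (2 * pi * real m * x))"
      by (intro tendsto_intros floor_dyadic_tendsto)
    moreover have "\<forall>\<^sub>F q in sequentially. complex_of_real (cos (2 * pi * real m * ?s q)) = F (?s q)"
      using eventually_ge_at_top[of p] by eventually_elim (simp only: dyadic)
    ultimately show "(\<lambda>q. F (?s q)) \<longlonglongrightarrow> complex_of_real (cos (2 * pi * real m * x))"
      by (rule Lim_transform_eventually)
  qed
  then show ?thesis
    using that by blast
qed

lemma circle_cosine_in_cosine_class: "circle_cosine k \<in> cosine_class circle_group circle_topology"
proof -
  let ?c = "circle_cosine k"
  have "continuous_on UNIV (?c \<circ> circle_proj)"
    unfolding comp_def circle_cosine_proj by (intro continuous_intros)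
  moreover have "bounded (?c ` carrier circle_group)"
    by (rule boundedI[of _ 1]) (auto simp: carrier_circle_group circle_cosine_proj)
  moreover have "?c \<in> extensional (carrier circle_group)"
    by (simp add: circle_cosine_def)
  moreover have "?c (circle_proj 0) \<noteq> 0"
    by (simp add: circle_cosine_proj)
  moreover have "?c (circle_proj x) * ?c (circle_proj y)
      = (?c (circle_proj (x + y)) + ?c (circle_proj (x - y))) / 2" for x y
    unfolding circle_cosine_proj of_real_mult[symmetric] cos_times_cos by (simp add: algebra_simps)
  ultimately show ?thesis
    unfolding cosine_class_def bounded_cts_def
    by (auto simp: carrier_circle_group continuous_map_circle_topology circle_mult circle_inv)
qed

lemma cosine_class_circle: "cosine_class circle_group circle_topology = range circle_cosine"
proof (intro antisym subsetI)
  fix \<phi> assume \<phi>: "\<phi> \<in> cosine_class circle_group circle_topology"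
  define F where "F = \<phi> \<circ> circle_proj"
  have "F x * F y = (F (x + y) + F (x - y)) / 2" for x y
  proof -
    have "\<phi> (circle_proj x) * \<phi> (circle_proj y)
        = (\<phi> (circle_proj x \<otimes>\<^bsub>circle_group\<^esub> circle_proj y)
           + \<phi> (circle_proj x \<otimes>\<^bsub>circle_group\<^esub> inv\<^bsub>circle_group\<^esub> circle_proj y)) / 2"
      by (intro cosine_class_dAlembert[OF \<phi>] circle_proj_in_carrier)
    then show ?thesis
      by (simp add: F_def circle_mult circle_inv)
  qed
  moreover have "F 0 = 1"
    using cosine_class_one[OF group_circle_group \<phi>] by (simp add: F_def circle_one)
  moreover have "circle_proj 1 = circle_proj 0"
    by (simp add: circle_proj_eq_iff)
  then have "F 1 = 1"
    using \<open>F 0 = 1\<close> by (simp add: F_def)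
  moreover have "continuous_on UNIV F"
    using \<phi> by (simp add: F_def cosine_class_def bounded_cts_def continuous_map_circle_topology)
  ultimately obtain m where m: "\<And>x. F x = complex_of_real (cos (2 * pi * real m * x))"
    using dAlembert_real_eq_cos[of F] by blast
  have "\<phi> = circle_cosine m"
  proof (rule extensionalityI)
    show "\<phi> \<in> extensional (carrier circle_group)"
      using \<phi> by (simp add: cosine_class_def bounded_cts_def)
    show "circle_cosine m \<in> extensional (carrier circle_group)"
      by (simp add: circle_cosine_def)
    show "\<phi> X = circle_cosine m X" if "X \<in> carrier circle_group" for X
      using that m by (auto simp: carrier_circle_group circle_cosine_proj F_def)
  qed
  then show "\<phi> \<in> range circle_cosine"
    by simp
qed (use circle_cosine_in_cosine_class in auto)

lemma inj_circle_cosine: "inj circle_cosine"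
proof (rule injI)
  fix k m assume eq: "circle_cosine k = circle_cosine m"
  show "k = m"
  proof (cases "k + m = 0")
    case False
    \<comment> \<open>At this point the two angles are \<open>\<pi> k / (k + m)\<close> and \<open>\<pi> m / (k + m)\<close>, both in \<open>[0, \<pi>]\<close>.\<close>
    define x where "x = 1 / (2 * (real k + real m))"
    have pos: "real k + real m > 0"
      using False by linarith
    have angle: "2 * pi * real j * x = pi * (real j / (real k + real m))" for j
      using pos by (simp add: x_def field_simps)
    have "cos (2 * pi * real k * x) = cos (2 * pi * real m * x)"
      using arg_cong[OF eq, of "\<lambda>c. c (circle_proj x)"] by (simp add: circle_cosine_proj)
    then have "cos (pi * (real k / (real k + real m))) = cos (pi * (real m / (real k + real m)))"
      unfolding angle .
    moreover have "0 \<le> pi * (real j / (real k + real m)) \<and> pi * (real j / (real k + real m)) \<le> pi"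
      if "j \<le> k + m" for j
    proof -
      have "real j / (real k + real m) \<le> 1"
        using pos that by simp
      then show ?thesis
        using mult_left_mono[of "real j / (real k + real m)" 1 pi] by simp
    qed
    ultimately have "pi * (real k / (real k + real m)) = pi * (real m / (real k + real m))"
      using cos_inj_pi by (metis le_add1 le_add2)
    then show ?thesis
      using pos by simp
  qed simp
qed

lemma circle_index_circle_cosine: "circle_index (circle_cosine k) = k"
  unfolding circle_index_def using inj_circle_cosine by (auto dest: injD)

section \<open>The index maps are homeomorphisms\<close>

theorem theorem10:
  shows "(cosine_class circle_group circle_topology = range circle_cosine \<and>
          (\<forall>k. circle_index (circle_cosine k) = k) \<and>
          homeomorphic_map (cosine_topology circle_group circle_topology)
            (discrete_topology UNIV) circle_index) \<and>
         (\<forall>n::nat. n > 0 \<longrightarrow>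
          cosine_class (integer_mod_group n) (cyclic_topology n)
            = cyclic_cosine n ` cyclic_index_set n \<and>
          (\<forall>l\<in>cyclic_index_set n. cyclic_index n (cyclic_cosine n l) = l) \<and>
          homeomorphic_map (cosine_topology (integer_mod_group n) (cyclic_topology n))
            (discrete_topology (cyclic_index_set n)) (cyclic_index n))"
proof (intro conjI allI impI ballI)
  show "cosine_class circle_group circle_topology = range circle_cosine"
    by (rule cosine_class_circle)
  show "circle_index (circle_cosine k) = k" for k
    by (rule circle_index_circle_cosine)
  have "cosine_topology circle_group circle_topology = discrete_topology (range circle_cosine)"
    using cosine_topology_compact[OF group_circle_group _ compact_space_circle_topology]
    by (simp add: cosine_class_circle)
  moreover have "homeomorphic_map (discrete_topology (range circle_cosine)) (discrete_topology UNIV) circle_index"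
    by (rule homeomorphic_map_discrete) (auto simp: circle_index_circle_cosine image_image intro!: inj_onI)
  ultimately show "homeomorphic_map (cosine_topology circle_group circle_topology)
      (discrete_topology UNIV) circle_index"
    by simp
next
  fix n :: nat assume n: "n > 0"
  show cyc: "cosine_class (integer_mod_group n) (cyclic_topology n) = cyclic_cosine n ` cyclic_index_set n"
    by (rule cosine_class_cyclic[OF n])
  show "cyclic_index n (cyclic_cosine n l) = l" if "l \<in> cyclic_index_set n" for l
    by (rule cyclic_index_cyclic_cosine[OF n that])
  have "compact_space (cyclic_topology n)"
    using n by (simp add: cyclic_topology_def compact_space_discrete_topology carrier_integer_mod_group)
  then have "cosine_topology (integer_mod_group n) (cyclic_topology n)
      = discrete_topology (cyclic_cosine n ` cyclic_index_set n)"
    using cosine_topology_compact[OF group_integer_mod_group[of n], of "cyclic_topology n"] cyc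
    by (simp add: cyclic_topology_def)
  moreover have "homeomorphic_map (discrete_topology (cyclic_cosine n ` cyclic_index_set n))
      (discrete_topology (cyclic_index_set n)) (cyclic_index n)"
    by (rule homeomorphic_map_discrete)
      (auto simp: cyclic_index_cyclic_cosine[OF n] image_image intro!: inj_onI)
  ultimately show "homeomorphic_map (cosine_topology (integer_mod_group n) (cyclic_topology n))
      (discrete_topology (cyclic_index_set n)) (cyclic_index n)"
    by simp
qed

end
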